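(* If the system $x_{k+1}=F_kx_k+G_kx_kw_k$, $y_k=H_kx_k$, $k=0,1,2,\dots$, is ESMS and $\{H_k\}_{k\in\mathcal N_0}$ is uniformly bounded, then the generalized Lyapunov equation $$-P_k+F_k^TP_{k+1}F_k+G_k^TP_{k+1}G_k+H_k^TH_k=0,\qquad k=0,1,2,\dots$$ admits a unique nonnegative definite solution $\{P_k\}_{k\in\mathcal N_0}$.
   Context: $\{w_k\}_{k\ge 0}$ is a one-dimensional independent white noise process on a probability space, with $E w_k=0$, $E[w_kw_j]=\delta_{kj}$; $\mathcal F_k=\sigma(w_0,\dots,w_k)$ and $\mathcal F_{-1}$ is the trivial sigma-algebra; $l^2_{\mathcal F_k}$ is the set of $\mathcal F_k$-measurable random vectors $x$ with $E\|x\|^2<\infty$. $\mathcal N_0=\{0,1,2,\dots\}$. $F_k,G_k\in\mathbb R^{n\times n}$, $H_k\in\mathbb R^{m\times n}$ are deterministic time-varying real matrices; $x_k\in\mathbb R^n$, $y_k\in\mathbb R^m$. Uniformly bounded means there is $M>0$ with $\|H_k\|\le M$ for all $k\in\mathcal N_0$. Nonnegative definite means real symmetric positive semi-definite for every $k$. ESMS (exponentially stable in mean square): there exist $\beta\ge 1$ and $\lambda\in(0,1)$ such that for any $0\le k_0\le k<+\infty$ and any state $x_{k_0}\in l^2_{\mathcal F_{k_0-1}}$ at time $k_0$, the trajectory started from $x_{k_0}$ satisfies $E\|x_k\|^2\le\beta E\|x_{k_0}\|^2\lambda^{k-k_0}$.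
   Formalization: Uniqueness is claimed only among uniformly bounded nonnegative definite solutions, and the solution is shown to be bounded; without boundedness uniqueness fails, e.g. F_k=I/2, G_k=0, H_k=0 has the solutions P_k=c4^k I for all c≥0. *)

theory Defs
  imports "HOL-Probability.Probability"
begin

definition white_noise :: "'a measure \<Rightarrow> (nat \<Rightarrow> 'a \<Rightarrow> real) \<Rightarrow> bool" where
  "white_noise M w \<longleftrightarrow>
     prob_space.indep_vars M (\<lambda>_. borel) w UNIV \<and>
     (\<forall>k. integrable M (\<lambda>\<omega>. (w k \<omega>)\<^sup>2)) \<and>
     (\<forall>k. integral\<^sup>L M (w k) = 0) \<and>
     (\<forall>k j. integral\<^sup>L M (\<lambda>\<omega>. w k \<omega> * w j \<omega>) = (if k = j then 1 else 0))"

(* The index is an integer so that the trivial sigma-algebra at time -1 (no generators) is included. *)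
definition noise_filtration :: "'a measure \<Rightarrow> (nat \<Rightarrow> 'a \<Rightarrow> real) \<Rightarrow> int \<Rightarrow> 'a measure" where
  "noise_filtration M w k =
     sigma (space M) {w j -` A \<inter> space M | j A. int j \<le> k \<and> A \<in> sets borel}"

definition l2_adapted ::
    "'a measure \<Rightarrow> (nat \<Rightarrow> 'a \<Rightarrow> real) \<Rightarrow> int \<Rightarrow> ('a \<Rightarrow> real ^ 'n) set" where
  "l2_adapted M w k =
     {x. x \<in> borel_measurable (noise_filtration M w k) \<and>
         integrable M (\<lambda>\<omega>. (norm (x \<omega>))\<^sup>2)}"

(* Only the values of x and y at times k \<ge> k0 are constrained. *)
definition system_trajectory ::
    "'a measure \<Rightarrow> (nat \<Rightarrow> 'a \<Rightarrow> real) \<Rightarrow> (nat \<Rightarrow> real ^ 'n ^ 'n) \<Rightarrow> (nat \<Rightarrow> real ^ 'n ^ 'n) \<Rightarrow>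
     (nat \<Rightarrow> real ^ 'n ^ 'm) \<Rightarrow> nat \<Rightarrow> (nat \<Rightarrow> 'a \<Rightarrow> real ^ 'n) \<Rightarrow> (nat \<Rightarrow> 'a \<Rightarrow> real ^ 'm) \<Rightarrow> bool" where
  "system_trajectory M w F G H k0 x y \<longleftrightarrow>
     (\<forall>k\<ge>k0. \<forall>\<omega>\<in>space M.
        x (Suc k) \<omega> = F k *v x k \<omega> + w k \<omega> *\<^sub>R (G k *v x k \<omega>) \<and>
        y k \<omega> = H k *v x k \<omega>)"

definition ESMS ::
    "'a measure \<Rightarrow> (nat \<Rightarrow> 'a \<Rightarrow> real) \<Rightarrow> (nat \<Rightarrow> real ^ 'n ^ 'n) \<Rightarrow> (nat \<Rightarrow> real ^ 'n ^ 'n) \<Rightarrow>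
     (nat \<Rightarrow> real ^ 'n ^ 'm) \<Rightarrow> bool" where
  "ESMS M w F G H \<longleftrightarrow>
     (\<exists>\<beta> l :: real. \<beta> \<ge> 1 \<and> 0 < l \<and> l < 1 \<and>
        (\<forall>k0 k x y. k0 \<le> k \<longrightarrow> x k0 \<in> l2_adapted M w (int k0 - 1) \<longrightarrow>
           system_trajectory M w F G H k0 x y \<longrightarrow>
           integral\<^sup>L M (\<lambda>\<omega>. (norm (x k \<omega>))\<^sup>2)
             \<le> \<beta> * integral\<^sup>L M (\<lambda>\<omega>. (norm (x k0 \<omega>))\<^sup>2) * l ^ (k - k0)))"

(* For matrices, norm is the Frobenius norm; all norms on matrices of a fixed size are equivalent,
   so the choice does not affect uniform boundedness. *)
definition uniformly_bounded :: "(nat \<Rightarrow> 'v :: real_normed_vector) \<Rightarrow> bool" where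
  "uniformly_bounded A \<longleftrightarrow> (\<exists>M>0. \<forall>k. norm (A k) \<le> M)"

definition nonneg_definite :: "real ^ 'n ^ 'n \<Rightarrow> bool" where
  "nonneg_definite P \<longleftrightarrow> transpose P = P \<and> (\<forall>v. 0 \<le> v \<bullet> (P *v v))"

definition generalized_lyapunov ::
    "(nat \<Rightarrow> real ^ 'n ^ 'n) \<Rightarrow> (nat \<Rightarrow> real ^ 'n ^ 'n) \<Rightarrow> (nat \<Rightarrow> real ^ 'n ^ 'm) \<Rightarrow>
     (nat \<Rightarrow> real ^ 'n ^ 'n) \<Rightarrow> bool" where
  "generalized_lyapunov F G H P \<longleftrightarrow>
     (\<forall>k. - P k + transpose (F k) ** P (Suc k) ** F k
            + transpose (G k) ** P (Suc k) ** G k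
            + transpose (H k) ** H k = 0)"

(* An ESMS system with uniformly bounded H can have many nonnegative definite solutions of this
   equation: for F k = (1/2) I, G k = 0, H k = 0, every P k = c 4^k I with c \<ge> 0 is one.
   Uniqueness is therefore to be asserted among uniformly bounded solutions. *)

end

theory Submission
  imports Defs
begin

text \<open>
  Write \<open>L\<^sub>k Q = F\<^sub>k\<^sup>T Q F\<^sub>k + G\<^sub>k\<^sup>T Q G\<^sub>k\<close>, so that the equation reads
  \<open>P\<^sub>k = L\<^sub>k P\<^sub>k\<^sub>+\<^sub>1 + H\<^sub>k\<^sup>T H\<^sub>k\<close>.  Unrolling it \<open>j\<close> times produces the composites
  \<open>T\<^sub>k\<^sub>,\<^sub>j = L\<^sub>k L\<^sub>k\<^sub>+\<^sub>1 \<dots> L\<^sub>k\<^sub>+\<^sub>j\<^sub>-\<^sub>1\<close>, and everything depends on how fast they decay.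

  Probability enters only to answer that question.  If \<open>x\<close> is the trajectory that starts from the
  deterministic vector \<open>v\<close> at time \<open>k\<close>, then \<open>E[x\<^sub>k\<^sub>+\<^sub>j\<^sup>T Q x\<^sub>k\<^sub>+\<^sub>j] = v\<^sup>T (T\<^sub>k\<^sub>,\<^sub>j Q) v\<close>
  (\<open>second_moment_flow\<close>): the state is independent of the next noise variable, which has mean zero
  and variance one, so averaging over one step replaces \<open>Q\<close> by \<open>L Q\<close>.  With \<open>Q = I\<close>, mean square
  stability becomes the deterministic estimate \<open>v\<^sup>T (T\<^sub>k\<^sub>,\<^sub>j I) v \<le> \<beta> l\<^sup>j |v|\<^sup>2\<close>, uniform in \<open>k\<close>
  (\<open>ESMS_imp_lyap_iter_decay\<close>).

  The operators \<open>L\<^sub>k\<close> preserve the order of quadratic forms.  Hence a symmetric \<open>Q\<close> with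
  \<open>-c I \<le> Q \<le> c I\<close> satisfies \<open>-c T\<^sub>k\<^sub>,\<^sub>j I \<le> T\<^sub>k\<^sub>,\<^sub>j Q \<le> c T\<^sub>k\<^sub>,\<^sub>j I\<close>, and the norm of
  \<open>T\<^sub>k\<^sub>,\<^sub>j Q\<close> is at most a constant times \<open>c l\<^sup>j\<close>.  This settles both halves
  (\<open>generalized_lyapunov_ex1\<close>).  Existence: the series
  \<open>P\<^sub>k = \<Sum>\<^sub>j T\<^sub>k\<^sub>,\<^sub>j (H\<^sub>k\<^sub>+\<^sub>j\<^sup>T H\<^sub>k\<^sub>+\<^sub>j)\<close> is dominated by a geometric one, uniformly in \<open>k\<close>,
  and splitting off its first term gives the equation.  Uniqueness: the difference \<open>D\<close> of two
  bounded solutions satisfies \<open>D\<^sub>k = T\<^sub>k\<^sub>,\<^sub>j D\<^sub>k\<^sub>+\<^sub>j\<close> for every \<open>j\<close>, and the right-hand side tends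
  to zero.
\<close>

section \<open>Quadratic forms\<close>

definition qform :: "real ^ 'n ^ 'n \<Rightarrow> real ^ 'n \<Rightarrow> real" where
  "qform Q v = v \<bullet> (Q *v v)"

lemma qform_add: "qform (Q + R) v = qform Q v + qform R v"
  by (simp add: qform_def matrix_vector_mult_add_rdistrib inner_add_right)

lemma qform_mat_1: "qform (mat 1) v = (norm v)\<^sup>2"
  by (simp add: qform_def power2_norm_eq_inner)

lemma inner_transpose_mult: "v \<bullet> ((transpose A ** B) *v u) = (A *v v) \<bullet> (B *v u)"
  for A B :: "real ^ 'n ^ 'm"
proof -
  have "v \<bullet> ((transpose A ** B) *v u) = ((B *v u) v* A) \<bullet> v"
    by (simp add: inner_commute flip: matrix_vector_mul_assoc)
  then show ?thesis by (metis dot_lmul_matrix inner_commute)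
qed

lemma qform_congruence: "qform (transpose A ** Q ** A) v = qform Q (A *v v)"
  by (simp add: qform_def matrix_mul_assoc[symmetric] inner_transpose_mult matrix_vector_mul_assoc)

lemma qform_gram: "qform (transpose A ** A) v = (norm (A *v v))\<^sup>2"
  by (simp add: qform_def inner_transpose_mult power2_norm_eq_inner)

lemma continuous_on_qform: "continuous_on UNIV (qform Q)"
  unfolding qform_def
  by (intro continuous_intros linear_continuous_on matrix_vector_mul_bounded_linear)

lemma norm_matrix_vector_mult_le: "norm (A *v v) \<le> norm A * norm v"
  for A :: "real ^ 'n ^ 'm"
proof -
  have "norm (A *v v) \<le> L2_set (\<lambda>i. norm (A $ i) * norm v) UNIV"
    unfolding norm_vec_def[of "A *v v"]
    by (intro L2_set_mono) (auto simp: matrix_vector_mul_component Cauchy_Schwarz_ineq2)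
  also have "\<dots> = norm A * norm v"
    by (simp add: norm_vec_def[of A] L2_set_left_distrib)
  finally show ?thesis .
qed

lemma abs_qform_le: "\<bar>qform Q v\<bar> \<le> norm Q * (norm v)\<^sup>2"
proof -
  have "\<bar>qform Q v\<bar> \<le> norm v * norm (Q *v v)"
    unfolding qform_def by (rule Cauchy_Schwarz_ineq2)
  also have "\<dots> \<le> norm v * (norm Q * norm v)"
    by (intro mult_left_mono norm_matrix_vector_mult_le) simp
  finally show ?thesis by (simp add: power2_eq_square mult_ac)
qed

text \<open>
  By polarization the form of a symmetric matrix controls each entry, with the parallelogram law
  turning the two values of the form into the constant \<open>c\<close>.  The dimensional factor is crude but
  harmless: only exponential decay in the number of steps matters later.
\<close>

lemma norm_symmetric_le_qform:
  fixes Q :: "real ^ 'n ^ 'n"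
  assumes sym: "transpose Q = Q" and bound: "\<And>v. \<bar>qform Q v\<bar> \<le> c * (norm v)\<^sup>2"
  shows "norm Q \<le> (real CARD('n))\<^sup>2 * c"
proof -
  have entry: "\<bar>Q $ a $ b\<bar> \<le> c" for a b
  proof -
    define x y :: "real ^ 'n" where "x = axis a 1" and "y = axis b 1"
    have Qab: "x \<bullet> (Q *v y) = Q $ a $ b"
      by (simp add: x_def y_def inner_axis' matrix_vector_mult_basis column_def)
    have "y \<bullet> (Q *v x) = Q $ b $ a"
      by (simp add: x_def y_def inner_axis' matrix_vector_mult_basis column_def)
    also have "\<dots> = Q $ a $ b"
      using arg_cong[OF sym, of "\<lambda>Q. Q $ a $ b"] by (simp add: transpose_def)
    finally have Qba: "y \<bullet> (Q *v x) = Q $ a $ b" .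
    have "4 * Q $ a $ b = qform Q (x + y) - qform Q (x - y)"
      using Qab Qba
      by (simp add: qform_def matrix_vector_right_distrib matrix_vector_mult_diff_distrib
          inner_add_left inner_add_right inner_diff_left inner_diff_right)
    then have "4 * \<bar>Q $ a $ b\<bar> \<le> \<bar>qform Q (x + y)\<bar> + \<bar>qform Q (x - y)\<bar>"
      by linarith
    also have "\<dots> \<le> c * ((norm (x + y))\<^sup>2 + (norm (x - y))\<^sup>2)"
      using bound[of "x + y"] bound[of "x - y"] by (simp add: algebra_simps)
    also have "(norm (x + y))\<^sup>2 + (norm (x - y))\<^sup>2 = 4"
      by (simp add: power2_norm_eq_inner inner_add_left inner_add_right inner_diff_left
          inner_diff_right) (simp add: x_def y_def inner_axis_axis)
    finally show ?thesis by simp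
  qed
  have "norm Q \<le> (\<Sum>a\<in>UNIV. norm (Q $ a))"
    unfolding norm_vec_def by (rule L2_set_le_sum) simp
  also have "\<dots> \<le> (\<Sum>a\<in>UNIV. \<Sum>b\<in>UNIV. \<bar>Q $ a $ b\<bar>)"
    by (intro sum_mono norm_le_l1_cart)
  also have "\<dots> \<le> (\<Sum>a\<in>(UNIV :: 'n set). \<Sum>b\<in>(UNIV :: 'n set). c)"
    by (intro sum_mono entry)
  finally show ?thesis by (simp add: power2_eq_square)
qed

section \<open>The Lyapunov operator and its iterates\<close>

definition lyap_op :: "real ^ 'n ^ 'n \<Rightarrow> real ^ 'n ^ 'n \<Rightarrow> real ^ 'n ^ 'n \<Rightarrow> real ^ 'n ^ 'n" where
  "lyap_op A B Q = transpose A ** Q ** A + transpose B ** Q ** B"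

lemma qform_lyap_op: "qform (lyap_op A B Q) v = qform Q (A *v v) + qform Q (B *v v)"
  by (simp add: lyap_op_def qform_add qform_congruence)

lemma linear_congruence: "linear (\<lambda>Q. transpose A ** Q ** A)"
  for A :: "real ^ 'n ^ 'n"
proof (rule linearI)
  have add: "(B + C) ** A = B ** A + C ** A" for B C :: "real ^ 'n ^ 'n"
    by (simp add: vec_eq_iff matrix_matrix_mult_def sum.distrib distrib_right)
  show "transpose A ** (Q + R) ** A = transpose A ** Q ** A + transpose A ** R ** A" for Q R
    by (simp only: matrix_add_ldistrib add)
  show "transpose A ** (c *\<^sub>R Q) ** A = c *\<^sub>R (transpose A ** Q ** A)" for c Q
    by (simp only: matrix_scalar_ac scalar_matrix_assoc[symmetric])
qed

lemma bounded_linear_lyap_op: "bounded_linear (lyap_op A B)"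
  unfolding lyap_op_def linear_conv_bounded_linear[symmetric]
  by (intro linear_compose_add linear_congruence)

lemma bounded_linear_transpose: "bounded_linear (transpose :: real ^ 'n ^ 'n \<Rightarrow> _)"
  unfolding linear_conv_bounded_linear[symmetric]
  by (rule linearI) (simp_all add: transpose_def vec_eq_iff)

lemma bounded_linear_qform: "bounded_linear (\<lambda>Q. qform Q v)"
  unfolding linear_conv_bounded_linear[symmetric]
  by (rule linearI) (simp_all add: qform_add, simp add: qform_def flip: scaleR_matrix_vector_assoc)

lemma transpose_lyap_op: "transpose (lyap_op A B Q) = lyap_op A B (transpose Q)"
  by (simp add: lyap_op_def matrix_transpose_mul matrix_mul_assoc
        linear_add[OF bounded_linear.linear[OF bounded_linear_transpose]])

text \<open>
  The recursion peels off the outermost operator, the one of the earliest time \<open>k\<close>; this is the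
  shape in which unrolling the Lyapunov equation forward in time produces the iterates.
\<close>

primrec lyap_iter ::
    "(nat \<Rightarrow> real ^ 'n ^ 'n) \<Rightarrow> (nat \<Rightarrow> real ^ 'n ^ 'n) \<Rightarrow> nat \<Rightarrow> nat \<Rightarrow> real ^ 'n ^ 'n \<Rightarrow> real ^ 'n ^ 'n"
  where
    "lyap_iter F G 0 k Q = Q"
  | "lyap_iter F G (Suc j) k Q = lyap_op (F k) (G k) (lyap_iter F G j (Suc k) Q)"

text \<open>
  Here the innermost operator, that of the latest time, is split off.  Expectations along a
  trajectory need this form, because there the last noise variable is averaged out first.
\<close>

lemma lyap_iter_Suc_right:
  "lyap_iter F G (Suc j) k Q = lyap_iter F G j k (lyap_op (F (k + j)) (G (k + j)) Q)"
  by (induction j arbitrary: k) auto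

lemma transpose_lyap_iter: "transpose (lyap_iter F G j k Q) = lyap_iter F G j k (transpose Q)"
  by (induction j arbitrary: k) (auto simp: transpose_lyap_op)

lemma qform_lyap_iter_nonneg:
  assumes "\<And>v. 0 \<le> qform Q v"
  shows "0 \<le> qform (lyap_iter F G j k Q) v"
  using assms by (induction j arbitrary: k v) (auto simp: qform_lyap_op)

text \<open>
  Each Lyapunov operator is monotone for the order of quadratic forms, because it evaluates the
  form at \<open>F\<^sub>k v\<close> and \<open>G\<^sub>k v\<close> and adds the results.  So comparing \<open>Q\<close> with \<open>c I\<close> survives
  iteration, and one bound for the identity matrix serves all right-hand sides.
\<close>

lemma abs_qform_lyap_iter_le:
  assumes "\<And>v. \<bar>qform Q v\<bar> \<le> c * (norm v)\<^sup>2"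
  shows "\<bar>qform (lyap_iter F G j k Q) v\<bar> \<le> c * qform (lyap_iter F G j k (mat 1)) v"
proof (induction j arbitrary: k v)
  case 0
  show ?case using assms by (simp add: qform_mat_1)
next
  case (Suc j)
  show ?case
    using Suc.IH[of "Suc k" "F k *v v"] Suc.IH[of "Suc k" "G k *v v"]
    by (simp add: qform_lyap_op distrib_left)
qed

text \<open>
  The inhomogeneous term cancels in the difference of two solutions, so the difference at time
  \<open>k\<close> is tied to the one arbitrarily far in the future.
\<close>

lemma solution_diff_eq_lyap_iter:
  assumes "generalized_lyapunov F G H P" "generalized_lyapunov F G H R"
  shows "P k - R k = lyap_iter F G j k (P (k + j) - R (k + j))"
proof (induction j arbitrary: k)
  case 0
  show ?case by simp
next
  case (Suc j)
  have step: "S k = lyap_op (F k) (G k) (S (Suc k)) + transpose (H k) ** H k"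
    if "generalized_lyapunov F G H S" for S
    using that unfolding generalized_lyapunov_def lyap_op_def
    by (simp add: algebra_simps eq_neg_iff_add_eq_0)
  have "P k - R k = lyap_op (F k) (G k) (P (Suc k) - R (Suc k))"
    using step[OF assms(1)] step[OF assms(2)]
    by (simp add: linear_diff[OF bounded_linear.linear[OF bounded_linear_lyap_op]])
  then show ?case using Suc.IH[of "Suc k"] by simp
qed

section \<open>Deterministic Lyapunov equation under a uniform exponential bound\<close>

text \<open>
  The hypothesis says \<open>T\<^sub>k\<^sub>,\<^sub>j I \<le> \<beta> l\<^sup>j I\<close> uniformly in \<open>k\<close>.  The key local fact is
  \<open>norm_iter\<close>, which extends this decay to all symmetric matrices.  It is used twice: on the Gram
  matrices of \<open>H\<close>, to sum the series for the solution, and on the difference of two bounded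
  solutions, to make it vanish.
\<close>

lemma generalized_lyapunov_ex1:
  fixes F G :: "nat \<Rightarrow> real ^ 'n ^ 'n" and H :: "nat \<Rightarrow> real ^ 'n ^ 'm"
  assumes decay: "\<And>j k v. qform (lyap_iter F G j k (mat 1)) v \<le> \<beta> * l ^ j * (norm v)\<^sup>2"
    and l: "0 < l" "l < 1"
    and H: "uniformly_bounded H"
  shows "\<exists>!P. (\<forall>k. nonneg_definite (P k)) \<and> uniformly_bounded P \<and> generalized_lyapunov F G H P"
proof -
  define N where "N = (real CARD('n))\<^sup>2"
  have norm_iter: "norm (lyap_iter F G j k Q) \<le> N * c * \<beta> * l ^ j"
    if sym: "transpose Q = Q" and c: "0 \<le> c" "\<And>v. \<bar>qform Q v\<bar> \<le> c * (norm v)\<^sup>2" for Q c j k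
  proof -
    have "norm (lyap_iter F G j k Q) \<le> N * (c * (\<beta> * l ^ j))"
      unfolding N_def
    proof (rule norm_symmetric_le_qform)
      show "transpose (lyap_iter F G j k Q) = lyap_iter F G j k Q"
        by (simp add: transpose_lyap_iter sym)
      show "\<bar>qform (lyap_iter F G j k Q) v\<bar> \<le> c * (\<beta> * l ^ j) * (norm v)\<^sup>2" for v
        using abs_qform_lyap_iter_le[OF c(2), of F G j k v] mult_left_mono[OF decay[of j k v] c(1)]
        by (simp add: mult_ac)
    qed
    then show ?thesis by (simp add: mult_ac)
  qed
  obtain C where C: "C > 0" "\<And>k. norm (H k) \<le> C"
    using H by (auto simp: uniformly_bounded_def)
  define S where "S k j = lyap_iter F G j k (transpose (H (k + j)) ** H (k + j))" for k j
  define P where "P k = (\<Sum>j. S k j)" for k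
  define K where "K = N * C\<^sup>2 * \<beta>"
  have sym_gram: "transpose (transpose (H k) ** H k) = transpose (H k) ** H k" for k
    by (simp add: matrix_transpose_mul)
  have norm_S: "norm (S k j) \<le> K * l ^ j" for k j
    unfolding S_def K_def
  proof (rule norm_iter[OF sym_gram])
    show "\<bar>qform (transpose (H (k + j)) ** H (k + j)) v\<bar> \<le> C\<^sup>2 * (norm v)\<^sup>2" for v
    proof -
      have "norm (H (k + j) *v v) \<le> C * norm v"
        by (rule order_trans[OF norm_matrix_vector_mult_le]) (simp add: C mult_right_mono)
      then show ?thesis
        by (simp add: qform_gram power_mono flip: power_mult_distrib)
    qed
  qed simp
  have geo: "(\<lambda>j. K * l ^ j) sums (K * (1 / (1 - l)))"
    using l by (intro sums_mult geometric_sums) auto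
  have norm_summable_S: "summable (\<lambda>j. norm (S k j))" for k
    by (rule summable_comparison_test'[OF sums_summable[OF geo], of 0]) (simp add: norm_S)
  then have summable_S: "summable (S k)" for k
    by (rule summable_norm_cancel)

  have nonneg: "nonneg_definite (P k)" for k
    unfolding nonneg_definite_def
  proof (intro conjI allI)
    show "transpose (P k) = P k"
    proof -
      have "transpose (P k) = (\<Sum>j. transpose (S k j))"
        unfolding P_def by (rule bounded_linear.suminf[OF bounded_linear_transpose summable_S])
      also have "\<dots> = P k"
        by (simp add: P_def S_def transpose_lyap_iter sym_gram)
      finally show ?thesis .
    qed
    show "0 \<le> v \<bullet> (P k *v v)" for v
    proof -
      have "0 \<le> (\<Sum>j. qform (S k j) v)"
        by (intro suminf_nonneg bounded_linear.summable[OF bounded_linear_qform] summable_S)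
           (simp add: S_def qform_lyap_iter_nonneg qform_gram)
      also have "\<dots> = qform (P k) v"
        unfolding P_def by (rule bounded_linear.suminf[OF bounded_linear_qform summable_S, symmetric])
      finally show ?thesis by (simp add: qform_def)
    qed
  qed
  have bounded: "uniformly_bounded P"
    unfolding uniformly_bounded_def
  proof (intro exI conjI allI)
    \<comment> \<open>The definition of boundedness wants a visibly positive constant, whereas the sign of \<open>\<beta>\<close>, and
      hence of \<open>K\<close>, is only implicit in the decay estimate.\<close>
    show "0 < \<bar>K * (1 / (1 - l))\<bar> + 1" by linarith
    show "norm (P k) \<le> \<bar>K * (1 / (1 - l))\<bar> + 1" for k
    proof -
      have "norm (P k) \<le> (\<Sum>j. norm (S k j))"
        unfolding P_def by (rule summable_norm[OF norm_summable_S])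
      also have "\<dots> \<le> (\<Sum>j. K * l ^ j)"
        by (intro suminf_le norm_S norm_summable_S sums_summable[OF geo])
      also have "\<dots> = K * (1 / (1 - l))" using geo by (rule sums_unique[symmetric])
      finally show ?thesis by linarith
    qed
  qed
  have solution: "generalized_lyapunov F G H P"
    unfolding generalized_lyapunov_def
  proof
    fix k
    have "P k = (\<Sum>j. S k (Suc j)) + S k 0"
      unfolding P_def using suminf_split_initial_segment[OF summable_S, of k 1] by simp
    also have "(\<Sum>j. S k (Suc j)) = (\<Sum>j. lyap_op (F k) (G k) (S (Suc k) j))"
      by (simp add: S_def)
    also have "\<dots> = lyap_op (F k) (G k) (P (Suc k))"
      unfolding P_def by (rule bounded_linear.suminf[OF bounded_linear_lyap_op summable_S, symmetric])
    also have "S k 0 = transpose (H k) ** H k" by (simp add: S_def)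
    finally show "- P k + transpose (F k) ** P (Suc k) ** F k + transpose (G k) ** P (Suc k) ** G k
        + transpose (H k) ** H k = 0"
      by (simp add: lyap_op_def)
  qed
  have unique: "R = P"
    if R: "\<forall>k. nonneg_definite (R k)" "uniformly_bounded R" "generalized_lyapunov F G H R" for R
  proof
    fix k
    obtain a where a: "a > 0" "\<And>k. norm (R k) \<le> a"
      using R(2) by (auto simp: uniformly_bounded_def)
    obtain b where b: "b > 0" "\<And>k. norm (P k) \<le> b"
      using bounded by (auto simp: uniformly_bounded_def)
    have le: "norm (R k - P k) \<le> N * (a + b) * \<beta> * l ^ j" for j
      unfolding solution_diff_eq_lyap_iter[OF R(3) solution, of k j]
    proof (rule norm_iter)
      show "transpose (R (k + j) - P (k + j)) = R (k + j) - P (k + j)"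
        using nonneg R(1)
        by (simp add: linear_diff[OF bounded_linear.linear[OF bounded_linear_transpose]] nonneg_definite_def)
      have "norm (R (k + j) - P (k + j)) \<le> a + b"
        by (rule order_trans[OF norm_triangle_ineq4 add_mono[OF a(2) b(2)]])
      then show "\<bar>qform (R (k + j) - P (k + j)) v\<bar> \<le> (a + b) * (norm v)\<^sup>2" for v
        by (intro order_trans[OF abs_qform_le] mult_right_mono) auto
    qed (use a b in simp)
    have "(\<lambda>j. N * (a + b) * \<beta> * l ^ j) \<longlonglongrightarrow> N * (a + b) * \<beta> * 0"
      using l by (intro tendsto_intros LIMSEQ_realpow_zero) auto
    then have "norm (R k - P k) \<le> 0"
      by (intro LIMSEQ_le_const[where X = "\<lambda>j. N * (a + b) * \<beta> * l ^ j"]) (auto intro: le)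
    then show "R k = P k" by simp
  qed
  show ?thesis
    using nonneg bounded solution unique by (intro ex1I[of _ P]) auto
qed

section \<open>Second moments along trajectories\<close>

text \<open>
  The state after \<open>j\<close> steps from \<open>v\<close> at time \<open>k\<close>, as a function of a noise path \<open>u\<close> rather than of
  a sample point.  Measurability of this function on a product space then makes independence of
  state and later noise a matter of disjoint index sets.
\<close>

primrec flow ::
    "(nat \<Rightarrow> real ^ 'n ^ 'n) \<Rightarrow> (nat \<Rightarrow> real ^ 'n ^ 'n) \<Rightarrow> nat \<Rightarrow> real ^ 'n \<Rightarrow> nat \<Rightarrow> (nat \<Rightarrow> real) \<Rightarrow> real ^ 'n"
  where
    "flow F G k v 0 u = v"
  | "flow F G k v (Suc j) u =
       F (k + j) *v flow F G k v j u + u (k + j) *\<^sub>R (G (k + j) *v flow F G k v j u)"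

lemma flow_cong:
  assumes "\<And>i. i < k + j \<Longrightarrow> u i = u' i"
  shows "flow F G k v j u = flow F G k v j u'"
  using assms by (induction j) auto

lemma measurable_matrix_vector_mult [measurable (raw)]:
  fixes A :: "real ^ 'n ^ 'm"
  assumes "f \<in> borel_measurable N"
  shows "(\<lambda>x. A *v f x) \<in> borel_measurable N"
  by (rule measurable_compose[OF assms borel_measurable_continuous_onI])
     (simp add: linear_continuous_on)

lemma measurable_flow:
  assumes "k + j \<le> n"
  shows "flow F G k v j \<in> borel_measurable (PiM {..<n} (\<lambda>_. borel))"
  using assms
proof (induction j)
  case 0
  have "flow F G k v 0 = (\<lambda>_. v)" by (simp add: fun_eq_iff)
  then show ?case by simp
next
  case (Suc j)
  have [measurable]: "(\<lambda>u. u (k + j)) \<in> borel_measurable (PiM {..<n} (\<lambda>_. borel :: real measure))"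
    using Suc.prems by (intro measurable_component_singleton) auto
  have [measurable]: "flow F G k v j \<in> borel_measurable (PiM {..<n} (\<lambda>_. borel))"
    using Suc by simp
  have "flow F G k v (Suc j) =
      (\<lambda>u. F (k + j) *v flow F G k v j u + u (k + j) *\<^sub>R (G (k + j) *v flow F G k v j u))"
    by (simp add: fun_eq_iff)
  then show ?case by simp
qed

context prob_space
begin

text \<open>
  The state at time \<open>k + j\<close> is a function of the noise before that time only.
\<close>

lemma indep_var_noise_qform_flow:
  assumes "indep_vars (\<lambda>_. borel) w UNIV"
  shows "indep_var borel (w (k + j)) borel (\<lambda>\<omega>. qform Q (flow F G k v j (\<lambda>i. w i \<omega>)))"
proof -
  let ?n = "k + j"
  have meas: "(\<lambda>u. qform Q (flow F G k v j u)) \<in> borel_measurable (PiM {..<?n} (\<lambda>_. borel))"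
    by (rule measurable_compose[OF measurable_flow
          borel_measurable_continuous_onI[OF continuous_on_qform]]) simp
  have "indep_var (PiM {?n} (\<lambda>_. borel)) (\<lambda>\<omega>. restrict (\<lambda>i. w i \<omega>) {?n})
      (PiM {..<?n} (\<lambda>_. borel)) (\<lambda>\<omega>. restrict (\<lambda>i. w i \<omega>) {..<?n})"
    using assms by (rule indep_var_restrict) auto
  from indep_var_compose[OF this _ meas, of "\<lambda>u. u ?n" borel]
  have "indep_var borel ((\<lambda>u. u ?n) \<circ> (\<lambda>\<omega>. restrict (\<lambda>i. w i \<omega>) {?n}))
      borel ((\<lambda>u. qform Q (flow F G k v j u)) \<circ> (\<lambda>\<omega>. restrict (\<lambda>i. w i \<omega>) {..<?n}))"
    by simp
  moreover have "flow F G k v j (restrict (\<lambda>i. w i \<omega>) {..<?n}) = flow F G k v j (\<lambda>i. w i \<omega>)" for \<omega>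
    by (rule flow_cong) simp
  ultimately show ?thesis by (simp add: o_def)
qed

text \<open>
  Expand the form of the next state in powers of the noise: the linear term has mean zero and the
  quadratic term contributes the form of \<open>G\<^sup>T Q G\<close> with weight one, both by independence.  What
  remains is the expectation of the form of \<open>L Q\<close> one step earlier, so the induction has to run
  over all \<open>Q\<close> at once.  Integrability is carried along because each product of independent
  integrable variables is integrable.
\<close>

lemma second_moment_flow:
  assumes "white_noise M w"
  shows "has_bochner_integral M (\<lambda>\<omega>. qform Q (flow F G k v j (\<lambda>i. w i \<omega>)))
           (qform (lyap_iter F G j k Q) v)"
proof (induction j arbitrary: Q)
  case 0
  show ?case by (simp add: has_bochner_integral_iff prob_space)
next
  case (Suc j)
  have indep: "indep_vars (\<lambda>_. borel) w UNIV"
    and w2: "integrable M (\<lambda>\<omega>. (w i \<omega>)\<^sup>2)" "expectation (\<lambda>\<omega>. (w i \<omega>)\<^sup>2) = 1"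
    and w1: "expectation (w i) = 0" for i
    using assms by (auto simp: white_noise_def power2_eq_square)
  have rv [measurable]: "w i \<in> borel_measurable M" for i
    using indep by (auto simp: indep_vars_def)
  have w1i: "integrable M (w i)" for i
    using w2(1) rv by (rule square_integrable_imp_integrable[rotated])
  let ?A = "F (k + j)" and ?B = "G (k + j)" and ?w = "w (k + j)"
  define X where "X \<omega> = flow F G k v j (\<lambda>i. w i \<omega>)" for \<omega>
  define C where "C = transpose ?A ** Q ** ?B + transpose ?B ** Q ** ?A"
  let ?QA = "transpose ?A ** Q ** ?A" and ?QB = "transpose ?B ** Q ** ?B"
  have IH: "integrable M (\<lambda>\<omega>. qform R (X \<omega>))"
    "expectation (\<lambda>\<omega>. qform R (X \<omega>)) = qform (lyap_iter F G j k R) v" for R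
    using Suc.IH[of R] by (simp_all add: X_def has_bochner_integral_iff)
  \<comment> \<open>The cross terms combine to the form of a single matrix, so that the induction hypothesis covers
    them as well and integrability of products of states needs no separate estimate.\<close>
  have expand: "qform Q (flow F G k v (Suc j) (\<lambda>i. w i \<omega>)) =
      qform ?QA (X \<omega>) + ?w \<omega> * qform C (X \<omega>) + (?w \<omega>)\<^sup>2 * qform ?QB (X \<omega>)" for \<omega>
  proof -
    have cross: "qform C x = (?A *v x) \<bullet> (Q *v (?B *v x)) + (?B *v x) \<bullet> (Q *v (?A *v x))" for x
      unfolding C_def qform_add
      unfolding qform_def matrix_mul_assoc[symmetric] inner_transpose_mult matrix_vector_mul_assoc ..
    show ?thesis
      unfolding cross qform_congruence
      by (simp add: X_def[symmetric] qform_def matrix_vector_right_distrib matrix_vector_mult_scaleR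
          inner_add_left inner_add_right algebra_simps power2_eq_square)
  qed
  have ind1: "indep_var borel ?w borel (\<lambda>\<omega>. qform C (X \<omega>))"
    unfolding X_def by (rule indep_var_noise_qform_flow[OF indep])
  have "indep_var borel ?w borel (\<lambda>\<omega>. qform ?QB (X \<omega>))"
    unfolding X_def by (rule indep_var_noise_qform_flow[OF indep])
  then have "indep_var borel ((\<lambda>x. x\<^sup>2) \<circ> ?w) borel ((\<lambda>x. x) \<circ> (\<lambda>\<omega>. qform ?QB (X \<omega>)))"
    by (rule indep_var_compose) simp_all
  then have ind2: "indep_var borel (\<lambda>\<omega>. (?w \<omega>)\<^sup>2) borel (\<lambda>\<omega>. qform ?QB (X \<omega>))"
    unfolding o_def .
  have int1: "integrable M (\<lambda>\<omega>. ?w \<omega> * qform C (X \<omega>))"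
    and exp1: "expectation (\<lambda>\<omega>. ?w \<omega> * qform C (X \<omega>)) = 0"
    using indep_var_integrable[OF ind1 w1i IH(1)]
      indep_var_lebesgue_integral[OF ind1 w1i IH(1), unfolded w1 mult_zero_left] .
  have int2: "integrable M (\<lambda>\<omega>. (?w \<omega>)\<^sup>2 * qform ?QB (X \<omega>))"
    and exp2: "expectation (\<lambda>\<omega>. (?w \<omega>)\<^sup>2 * qform ?QB (X \<omega>)) = expectation (\<lambda>\<omega>. qform ?QB (X \<omega>))"
    using indep_var_integrable[OF ind2 w2(1) IH(1)]
      indep_var_lebesgue_integral[OF ind2 w2(1) IH(1), unfolded w2(2) mult_1_left] .
  have "integrable M (\<lambda>\<omega>. qform Q (flow F G k v (Suc j) (\<lambda>i. w i \<omega>)))"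
    unfolding expand by (intro Bochner_Integration.integrable_add IH int1 int2)
  moreover have "expectation (\<lambda>\<omega>. qform Q (flow F G k v (Suc j) (\<lambda>i. w i \<omega>))) =
      expectation (\<lambda>\<omega>. qform ?QA (X \<omega>)) + expectation (\<lambda>\<omega>. qform ?QB (X \<omega>))"
    unfolding expand using IH(1) int1 int2 exp1 exp2 by simp
  moreover have "\<dots> = expectation (\<lambda>\<omega>. qform (lyap_op ?A ?B Q) (X \<omega>))"
    using IH(1) by (simp add: lyap_op_def qform_add)
  moreover have "\<dots> = qform (lyap_iter F G (Suc j) k Q) v"
    by (simp only: IH(2) lyap_iter_Suc_right)
  ultimately show ?case by (simp only: has_bochner_integral_iff)
qed

text \<open>
  Constant initial states are measurable for every sigma-algebra of the filtration, so stability
  may be tested on them at every starting time.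
\<close>

lemma ESMS_imp_lyap_iter_decay:
  fixes H :: "nat \<Rightarrow> real ^ 'n ^ 'm"
  assumes "white_noise M w" "ESMS M w F G H"
  obtains \<beta> l where "0 < l" "l < 1"
    "\<And>j k v. qform (lyap_iter F G j k (mat 1)) v \<le> \<beta> * l ^ j * (norm v)\<^sup>2"
proof -
  obtain \<beta> l where l: "0 < l" "l < 1"
    and stable: "\<And>k0 k x y. k0 \<le> k \<Longrightarrow> x k0 \<in> l2_adapted M w (int k0 - 1) \<Longrightarrow>
           system_trajectory M w F G H k0 x y \<Longrightarrow>
           expectation (\<lambda>\<omega>. (norm (x k \<omega>))\<^sup>2)
             \<le> \<beta> * expectation (\<lambda>\<omega>. (norm (x k0 \<omega>))\<^sup>2) * l ^ (k - k0)"
    using assms(2) unfolding ESMS_def by blast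
  have "qform (lyap_iter F G j k (mat 1)) v \<le> \<beta> * l ^ j * (norm v)\<^sup>2" for j k v
  proof -
    \<comment> \<open>Truncated subtraction freezes the process at \<open>v\<close> before time \<open>k\<close>, where a trajectory started
      at \<open>k\<close> is unconstrained.\<close>
    define x where "x i \<omega> = flow F G k v (i - k) (\<lambda>i. w i \<omega>)" for i \<omega>
    have "system_trajectory M w F G H k x (\<lambda>i \<omega>. H i *v x i \<omega>)"
      by (simp add: system_trajectory_def x_def Suc_diff_le)
    moreover have "x k = (\<lambda>_. v)" by (simp add: x_def fun_eq_iff)
    then have "x k \<in> l2_adapted M w (int k - 1)" by (simp add: l2_adapted_def)
    ultimately have "expectation (\<lambda>\<omega>. (norm (x (k + j) \<omega>))\<^sup>2)
        \<le> \<beta> * expectation (\<lambda>\<omega>. (norm (x k \<omega>))\<^sup>2) * l ^ (k + j - k)"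
      by (intro stable) auto
    then show ?thesis
      using has_bochner_integral_integral_eq[OF second_moment_flow[OF assms(1)], of "mat 1" F G k v j]
      by (simp add: x_def qform_mat_1 prob_space mult_ac)
  qed
  with l that show ?thesis by blast
qed

end

theorem theorem2p2p1:
  fixes M :: "'a measure"
    and w :: "nat \<Rightarrow> 'a \<Rightarrow> real"
    and F G :: "nat \<Rightarrow> real ^ 'n ^ 'n"
    and H :: "nat \<Rightarrow> real ^ 'n ^ 'm"
  assumes "prob_space M"
    and "white_noise M w"
    and "ESMS M w F G H"
    and "uniformly_bounded H"
  shows "\<exists>!P. (\<forall>k. nonneg_definite (P k)) \<and> uniformly_bounded P \<and> generalized_lyapunov F G H P"
proof -
  obtain \<beta> l where "0 < l" "l < 1"
    "\<And>j k v. qform (lyap_iter F G j k (mat 1)) v \<le> \<beta> * l ^ j * (norm v)\<^sup>2"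
    using prob_space.ESMS_imp_lyap_iter_decay[OF assms(1-3)] by metis
  then show ?thesis by (intro generalized_lyapunov_ex1 assms(4))
qed

end
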